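(* Let $k\in\mathbb{N}$, $s\in\mathbb{C}\setminus\{1,\dots,k\}$ and $\Re v>0$. Then $$\zeta(s,v)=\frac{k!}{(s-k)_k}\sum_{n=0}^\infty\frac{|S_1(n+k,k)|}{(n+k)!}\sum_{l=0}^{n+k-1}(-1)^l\binom{n+k-1}{l}(l+v)^{k-s} =\frac{k!}{(s-k)_k}\sum_{n=0}^\infty\frac{|S_1(n+k,k)|}{(n+k)!}\sum_{r=0}^{k-1}(-1)^r\binom{k-1}{r}\sum_{l=0}^{n}(-1)^l\binom{n}{l}(l+r+v)^{k-s}.$$ In particular, for $k=2$, $$\zeta(s,v)=\frac{2}{(s-1)(s-2)}\sum_{n=0}^\infty\frac{H_{n+1}}{n+2}\sum_{l=0}^{n+1}(-1)^l\binom{n+1}{l}(l+v)^{2-s}=\frac{2}{(s-1)(s-2)}\sum_{n=0}^\infty\frac{H_{n+1}}{n+2}\sum_{l=0}^{n}(-1)^l\binom{n}{l}\Big\{(l+v)^{2-s}-(l+v+1)^{2-s}\Big\},$$ and for $k=3$, $$\zeta(s,v)=\frac{3}{(s-1)(s-2)(s-3)}\sum_{n=0}^\infty\frac{H^2_{n+2}-H^{(2)}_{n+2}}{n+3}\sum_{l=0}^{n+2}(-1)^l\binom{n+2}{l}(l+v)^{3-s}.$$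
   Context: $\zeta(s,v)$ is the Hurwitz zeta-function. $(x)_k=x(x+1)\cdots(x+k-1)$ is the rising factorial, so $(s-k)_k=(s-k)(s-k+1)\cdots(s-1)$. $S_1(n,l)$ are the Stirling numbers of the first kind, defined by $x(x-1)\cdots(x-n+1)=\sum_{l}S_1(n,l)x^l$. $H_n=\sum_{j=1}^n\frac1j$ and $H^{(2)}_n=\sum_{j=1}^nj^{-2}$. *)

theory Defs
  imports
    "HOL-Complex_Analysis.Complex_Analysis"
    "HOL-Computational_Algebra.Polynomial"
begin

text \<open>
  For \<open>Re v > 0\<close>, the Hurwitz zeta function is the analytic continuation to \<open>\<complex> - {1}\<close> of
  the Dirichlet-type series in the half-plane \<open>Re s > 1\<close>. Powers are principal values.
  The condition \<open>f 1 = 0\<close> only fixes a dummy value at the pole, so that the description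
  is unique.
\<close>

definition hurwitz_zeta :: "complex \<Rightarrow> complex \<Rightarrow> complex" where
  "hurwitz_zeta s v =
     (THE f. f holomorphic_on (- {1}) \<and> f 1 = 0 \<and>
        (\<forall>z. Re z > 1 \<longrightarrow> (\<lambda>n. 1 / (of_nat n + v) powr z) sums f z)) s"

text \<open>Signed Stirling numbers of the first kind: coefficients of \<open>x (x - 1) \<dots> (x - n + 1)\<close>.\<close>

definition S1 :: "nat \<Rightarrow> nat \<Rightarrow> int" where
  "S1 n l = poly.coeff (\<Prod>i<n. [:- int i, 1:]) l"

definition harm2 :: "nat \<Rightarrow> complex" where
  "harm2 n = (\<Sum>j=1..n. 1 / (of_nat j)\<^sup>2)"

text \<open>The identity \<open>a = c \<Sum> f n\<close>, including convergence of the series.\<close>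

definition eq_series :: "complex \<Rightarrow> complex \<Rightarrow> (nat \<Rightarrow> complex) \<Rightarrow> bool" where
  "eq_series a c f \<longleftrightarrow> summable f \<and> a = c * (\<Sum>n. f n)"

end

theory Submission
  imports Defs "HOL-Combinatorics.Stirling"
begin

text \<open>
  With \<open>u = 1 - exp (- t)\<close>, the exponential generating function
  \<open>t ^ k / k! = (\<Sum>n. |S1 n k| / n! * u ^ n)\<close> turns the Mellin integral of
  \<open>t powr (s - 1) * exp (- v * t) / u\<close>, which is \<open>Gamma s\<close> times the Hurwitz series, into a
  weighted series of integrals of \<open>t powr (s - k - 1) * exp (- v * t) * u ^ m\<close>. These are
  \<open>Gamma (s - k)\<close> times the \<open>m\<close>-th alternating differences of \<open>(l + v) powr (k - s)\<close>. This proves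
  the formula for \<open>Re s > k\<close>. The differences are \<open>O(m powr - \<sigma>)\<close> for every \<open>\<sigma> < Re v\<close>, locally
  uniformly in all of the complex plane, while the weights are \<open>O(log n ^ (k - 1) / n)\<close>; hence the
  series is entire in \<open>s\<close>. For \<open>k = 1\<close> it provides the analytic continuation of the Hurwitz
  series, and for general \<open>k\<close> the identity theorem extends the formula.
\<close>

section \<open>Alternating binomial sums as iterated differences\<close>

text \<open>This is \<open>(1 - E) ^ m\<close> applied to \<open>f\<close> and evaluated at 0, where
  \<open>E\<close> is the shift operator.\<close>

definition alt_binomial_sum :: "nat \<Rightarrow> (nat \<Rightarrow> complex) \<Rightarrow> complex" where
  "alt_binomial_sum m f = (\<Sum>l\<le>m. (-1) ^ l * of_nat (m choose l) * f l)"

lemma alt_binomial_sum_0 [simp]: "alt_binomial_sum 0 f = f 0"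
  by (simp add: alt_binomial_sum_def)

text \<open>Pascal's rule; in operator form, one factor \<open>1 - E\<close> is split off.\<close>

lemma alt_binomial_sum_Suc:
  "alt_binomial_sum (Suc m) f = alt_binomial_sum m f - alt_binomial_sum m (\<lambda>l. f (Suc l))"
proof -
  have "alt_binomial_sum (Suc m) f =
      f 0 + (\<Sum>l\<le>m. (-1) ^ Suc l * of_nat (Suc m choose Suc l) * f (Suc l))"
    unfolding alt_binomial_sum_def by (subst sum.atMost_Suc_shift) simp
  also have "(\<Sum>l\<le>m. (-1) ^ Suc l * of_nat (Suc m choose Suc l) * f (Suc l)) =
      (\<Sum>l\<le>m. (-1) ^ Suc l * of_nat (m choose Suc l) * f (Suc l)) - alt_binomial_sum m (\<lambda>l. f (Suc l))"
    unfolding alt_binomial_sum_def sum_subtractf [symmetric]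
    by (intro sum.cong) (auto simp: algebra_simps)
  also have "f 0 + \<dots> =
     (\<Sum>l\<le>Suc m. (-1) ^ l * of_nat (m choose l) * f l) - alt_binomial_sum m (\<lambda>l. f (Suc l))"
    by (subst sum.atMost_Suc_shift) simp
  also have "(\<Sum>l\<le>Suc m. (-1) ^ l * of_nat (m choose l) * f l) = alt_binomial_sum m f"
    by (simp add: alt_binomial_sum_def)
  finally show ?thesis .
qed

lemma alt_binomial_sum_diff:
  "alt_binomial_sum m (\<lambda>l. f l - g l) = alt_binomial_sum m f - alt_binomial_sum m g"
  by (simp add: alt_binomial_sum_def sum_subtractf [symmetric] algebra_simps)

text \<open>\<open>(1 - E) ^ (j + n)\<close> is the product of its two powers, the outer one acting
  on the shift \<open>r\<close>. This is the source of the double sum in the theorem.\<close>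

lemma alt_binomial_sum_add_order:
  "alt_binomial_sum (j + n) f = alt_binomial_sum j (\<lambda>r. alt_binomial_sum n (\<lambda>l. f (l + r)))"
proof (induction j arbitrary: f)
  case (Suc j)
  show ?case
    using Suc[of f] Suc[of "\<lambda>l. f (Suc l)"] by (simp add: alt_binomial_sum_Suc)
qed simp

text \<open>A discrete product rule: the absorption identity
  \<open>Suc l * (Suc m choose Suc l) = Suc m * (m choose l)\<close> trades the factor
  \<open>l\<close> for a difference of one order less.\<close>

lemma alt_binomial_sum_times_affine:
  "alt_binomial_sum (Suc m) (\<lambda>l. (of_nat l + v) * f l) =
     v * alt_binomial_sum (Suc m) f - of_nat (Suc m) * alt_binomial_sum m (\<lambda>l. f (Suc l))"
proof -
  have "(\<Sum>l\<le>Suc m. (-1) ^ l * of_nat (Suc m choose l) * (of_nat l * f l)) =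
        (\<Sum>l\<le>m. (-1) ^ Suc l * of_nat (Suc l * (Suc m choose Suc l)) * f (Suc l))"
    by (subst sum.atMost_Suc_shift) (simp add: algebra_simps del: binomial_Suc_Suc)
  also have "\<dots> = - (of_nat (Suc m) * alt_binomial_sum m (\<lambda>l. f (Suc l)))"
    unfolding Suc_times_binomial
    unfolding alt_binomial_sum_def sum_distrib_left sum_negf [symmetric]
    by (intro sum.cong) (auto simp: algebra_simps)
  finally show ?thesis
    by (simp add: alt_binomial_sum_def algebra_simps sum.distrib sum_distrib_left
             del: of_nat_Suc binomial_Suc_Suc)
qed

section \<open>Stirling numbers of the first kind: signs, growth and generating function\<close>

text \<open>Expanding the last factor of the product gives the signed Stirling recurrence, whose
  signs collect into \<open>(-1) ^ (n + k)\<close>.\<close>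

lemma abs_S1: "\<bar>S1 n k\<bar> = int (stirling n k)"
proof -
  have step: "S1 (Suc n) 0 = - int n * S1 n 0" "S1 (Suc n) (Suc l) = S1 n l - int n * S1 n (Suc l)"
    for n l
    by (simp_all add: S1_def mult.commute[of _ "[:- int n, 1:]"])
  have "S1 n k = (-1) ^ (n + k) * int (stirling n k)"
  proof (induction n k rule: stirling.induct)
    case (3 n)
    \<comment> \<open>The factor with \<open>i = 0\<close> is \<open>x\<close> itself, so the
      constant coefficient vanishes.\<close>
    have "S1 (Suc n) 0 = 0" by (induction n) (simp_all add: step(1))
    then show ?case by simp
  qed (simp_all add: step, simp_all add: S1_def algebra_simps)
  thus ?thesis by (simp add: abs_mult power_abs)
qed

lemma stirling_le_fact: "stirling n k \<le> fact n"
proof (cases "k \<le> n")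
  case True
  then have "stirling n k \<le> (\<Sum>k\<le>n. stirling n k)" by (intro member_le_sum) auto
  thus ?thesis by (simp add: sum_stirling)
qed simp

text \<open>The left-hand side is the elementary symmetric polynomial of degree \<open>k\<close> in
  \<open>1, 1/2, ..., 1/n\<close>, all of whose monomials occur in the expansion of
  \<open>harm n ^ k\<close>. The induction adjoins the variable \<open>1/(n+1)\<close>.\<close>

lemma stirling_Suc_Suc_le_harm_power:
  "real (stirling (Suc n) (Suc k)) / fact n \<le> harm n ^ k"
proof (induction n arbitrary: k)
  case 0
  then show ?case by (cases k) (auto simp: harm_def)
next
  case (Suc n)
  show ?case
  proof (cases k)
    case 0
    then show ?thesis by (simp add: stirling_Suc_n_1 del: stirling.simps fact_Suc)
  next
    case [simp]: (Suc j)
    have "real (stirling (Suc (Suc n)) (Suc k)) / fact (Suc n) =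
        real (stirling (Suc n) (Suc k)) / fact n + 
        inverse (real (Suc n)) * (real (stirling (Suc n) (Suc j)) / fact n)"
      unfolding stirling.simps(4)[of "Suc n"] fact_Suc of_nat_add of_nat_mult Suc
      by (simp add: field_simps del: stirling.simps of_nat_Suc)
    also have "\<dots> \<le> harm n ^ k + inverse (real (Suc n)) * harm n ^ j"
      by (intro add_mono mult_left_mono Suc.IH) auto
    also have "\<dots> = harm (Suc n) * harm n ^ j"
      by (simp add: harm_Suc algebra_simps)
    also have "\<dots> \<le> harm (Suc n) * harm (Suc n) ^ j"
      by (intro mult_left_mono power_mono harm_mono harm_nonneg) auto
    finally show ?thesis by simp
  qed
qed

text \<open>For positive \<open>k\<close> both sides vanish at \<open>u = 0\<close>, and their
  derivatives are the respective sides for \<open>k - 1\<close> divided by \<open>1 - u\<close>;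
  induction on \<open>k\<close> identifies them.\<close>

lemma stirling_exp_gf:
  fixes u :: real
  assumes "0 \<le> u" "u < 1"
  shows "(\<lambda>n. real (stirling n k) / fact n * u ^ n) sums ((- ln (1 - u)) ^ k / fact k)"
proof -
  define c where "c = (\<lambda>k n. real (stirling n k) / fact n)"
  define f where "f = (\<lambda>k x. \<Sum>n. c k n * x ^ n)"
  have c01: "c k n \<le> 1" "c k n \<ge> 0" for k n
    using of_nat_mono[OF stirling_le_fact[of n k], where ?'a = real]
    by (simp_all add: c_def divide_simps)
  have summ: "summable (\<lambda>n. c k n * x ^ n)" if "norm x < 1" for x :: real and k
  proof (rule summable_comparison_test)
    show "summable (\<lambda>n. norm x ^ n)" using that by (intro summable_geometric) auto
    have "norm (c k n * x ^ n) \<le> norm x ^ n" for n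
      using c01[of k n] by (simp add: abs_mult power_abs mult_left_le_one_le)
    thus "\<exists>N. \<forall>n\<ge>N. norm (c k n * x ^ n) \<le> norm x ^ n" by blast
  qed
  have summ_diffs: "summable (\<lambda>n. diffs (c k) n * x ^ n)" if "norm x < 1" for x :: real and k
    using that summ by (intro termdiff_converges[of x 1]) auto
  \<comment> \<open>The Stirling recurrence divided by \<open>fact n\<close>. It is the coefficient
    form of \<open>F' = x * F' + f k x\<close> for \<open>F = f (Suc k)\<close>.\<close>
  have rec: "diffs (c (Suc k)) n = real n * c (Suc k) n + c k n" for k n
    by (simp add: diffs_def c_def divide_simps)
  have deriv: "(f (Suc k) has_real_derivative (f k x / (1 - x))) (at x)" if "norm x < 1" for k x
  proof -
    define d where "d = (\<Sum>n. diffs (c (Suc k)) n * x ^ n)"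
    have D: "(f (Suc k) has_real_derivative d) (at x)"
      unfolding f_def d_def using that summ by (intro termdiffs_strong'[of 1]) auto
    have "(\<lambda>n. diffs (c (Suc k)) n * x ^ n) sums d"
      using summ_diffs[OF that] by (simp add: d_def summable_sums)
    from sums_mult[OF this, of x] have 1: "(\<lambda>n. diffs (c (Suc k)) n * x ^ Suc n) sums (x * d)"
      by (simp add: mult_ac)
    have "(\<lambda>n. real n * c (Suc k) n * x ^ n) sums (x * d)"
      using 1 sums_Suc_iff[of "\<lambda>n. real n * c (Suc k) n * x ^ n" "x * d"] by (simp add: diffs_def)
    moreover have "(\<lambda>n. c k n * x ^ n) sums f k x"
      using summ[OF that] by (simp add: f_def summable_sums)
    ultimately have "(\<lambda>n. diffs (c (Suc k)) n * x ^ n) sums (x * d + f k x)"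
      using sums_add by (fastforce simp: rec algebra_simps)
    hence "d = x * d + f k x"
      using summ_diffs[OF that] by (simp add: d_def sums_iff)
    hence "d = f k x / (1 - x)" using that by (simp add: divide_simps) (simp add: algebra_simps)
    with D show ?thesis by simp
  qed
  have f0: "f (Suc k) 0 = 0" for k
    using powser_zero[of "c (Suc k)"] by (simp add: f_def) (simp add: c_def)
  have "f k x = (- ln (1 - x)) ^ k / fact k" if "0 \<le> x" "x < 1" for x
    using that
  proof (induction k arbitrary: x)
    case 0
    have "(\<lambda>n. c 0 n * x ^ n) = (\<lambda>n. if n = 0 then 1 else 0)"
      by (auto simp: c_def fun_eq_iff)
    then show ?case using sums_single[of 0 "\<lambda>_. 1 :: real"] by (simp add: f_def sums_iff)
  next
    case (Suc k)
    define h where "h = (\<lambda>x. f (Suc k) x - (- ln (1 - x)) ^ Suc k / fact (Suc k))"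
    have "(h has_real_derivative 0) (at y)" if "0 \<le> y" "y \<le> x" for y
    proof -
      have y: "norm y < 1" "y < 1" using that Suc.prems by auto
      have "((\<lambda>x. (- ln (1 - x)) ^ Suc k / fact (Suc k)) has_real_derivative
              ((- ln (1 - y)) ^ k / fact k / (1 - y))) (at y)"
        using y by (auto intro!: derivative_eq_intros simp: field_simps simp del: power_Suc of_nat_Suc)
      from DERIV_diff[OF deriv[OF y(1), of k] this] show ?thesis
        using Suc.IH[of y] that y by (simp add: h_def)
    qed
    then have "h x = h 0" if "x \<noteq> 0"
      using Suc.prems that
      by (intro DERIV_isconst_end DERIV_continuous_on[where D = "\<lambda>_. 0"])
         (auto intro: has_field_derivative_at_within)
    then have "h x = h 0" by blast
    then show ?case by (simp add: h_def f0)
  qed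
  thus ?thesis using summ[of u k] assms by (simp add: f_def c_def sums_iff)
qed

section \<open>Mellin integrals of exponentials\<close>

abbreviation lborel_pos :: "real measure" where
  "lborel_pos \<equiv> restrict_space lborel {0<..}"

text \<open>Equal to \<open>t powr (w - 1) * exp (- v * t)\<close> for \<open>t > 0\<close>; this form makes measurability and
  the change of parameters immediate.\<close>

definition gamma_kernel :: "complex \<Rightarrow> complex \<Rightarrow> real \<Rightarrow> complex" where
  "gamma_kernel w v t = exp ((w - 1) * of_real (ln t) - v * of_real t)"

lemma gamma_kernel_measurable [measurable]: "gamma_kernel w v \<in> borel_measurable borel"
  unfolding gamma_kernel_def by measurable

text \<open>Only the real part of the exponent affects the norm, so integrals of norms reduce to
  real parameters.\<close>

lemma norm_gamma_kernel:
  "norm (gamma_kernel w v t) = Re (gamma_kernel (of_real (Re w)) (of_real (Re v)) t)"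
  by (simp add: gamma_kernel_def Re_exp)

lemma gamma_kernel_shift:
  assumes "t > 0"
  shows "gamma_kernel (w + of_nat n) v t = of_real t ^ n * gamma_kernel w v t"
proof -
  have "of_real t ^ n = exp (of_nat n * complex_of_real (ln t))"
    using assms by (simp add: exp_of_nat_mult exp_of_real)
  then show ?thesis
    by (simp add: gamma_kernel_def exp_add [symmetric] algebra_simps)
qed

lemma gamma_kernel_add: "gamma_kernel w (v + u) t = gamma_kernel w v t * exp (- u * of_real t)"
  by (simp add: gamma_kernel_def exp_add [symmetric] algebra_simps)

lemma not_nonpos_Int: "Re w > 0 \<Longrightarrow> w \<notin> \<int>\<^sub>\<le>\<^sub>0"
  by (auto elim!: nonpos_Ints_cases)

text \<open>Carries Euler's integral over from the gauge integral to a Bochner integral; Borel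
  measurability justifies passing from the completed measure \<open>lebesgue\<close> back to
  \<open>lborel\<close>.\<close>

lemma has_bochner_integral_gamma_kernel_1:
  assumes "Re w > 0"
  shows "has_bochner_integral lborel_pos (gamma_kernel w 1) (Gamma w)"
proof -
  have eq: "of_real t powr (w - 1) / of_real (exp t) = gamma_kernel w 1 t" if "t \<in> {0<..}" for t
    using that by (simp add: gamma_kernel_def powr_def Ln_of_real exp_diff exp_of_real)
  have 1: "set_integrable lebesgue {0<..} (gamma_kernel w 1)"
    using absolutely_integrable_Gamma_integral'[OF assms]
    by (subst set_integrable_cong[OF refl refl eq[symmetric]]) auto
  have 2: "(gamma_kernel w 1 has_integral Gamma w) {0<..}"
    by (rule has_integral_eq[OF eq Gamma_integral_complex'[OF assms]])
  have 3: "set_lebesgue_integral lebesgue {0<..} (gamma_kernel w 1) = Gamma w"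
    using set_lebesgue_integral_eq_integral(2)[OF 1] 2 by (simp add: integral_unique)
  have meas: "(\<lambda>x. indicat_real {0<..} x *\<^sub>R gamma_kernel w 1 x) \<in> borel_measurable lborel"
    by measurable
  show ?thesis
    using 1 3 integrable_completion[OF meas] integral_completion[OF meas]
    by (simp add: has_bochner_integral_iff integrable_restrict_space integral_restrict_space
        set_integrable_def set_lebesgue_integral_def)
qed

text \<open>Substituting \<open>c * x\<close> in the integral with parameter 1 produces
  \<open>c powr (w - 1)\<close> from the kernel and \<open>1 / c\<close> from the measure.\<close>

lemma has_bochner_integral_gamma_kernel_of_real:
  assumes "Re w > 0" "c > 0"
  shows "has_bochner_integral lborel_pos (gamma_kernel w (of_real c)) (Gamma w * of_real c powr - w)"
proof -
  have "has_bochner_integral lborel (\<lambda>x. indicator {0<..} x *\<^sub>R gamma_kernel w 1 x) (Gamma w)"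
    using has_bochner_integral_gamma_kernel_1[OF assms(1)]
    by (simp add: has_bochner_integral_restrict_space)
  then have *: "has_bochner_integral lborel
        (\<lambda>x. indicator {0<..} (c * x) *\<^sub>R gamma_kernel w 1 (c * x)) (Gamma w /\<^sub>R c)"
    using assms(2) by (subst (asm) lborel_has_bochner_integral_real_affine_iff[of c _ _ 0]) auto
  have scale: "indicator {0<..} (c * x) *\<^sub>R gamma_kernel w 1 (c * x) =
          of_real c powr (w - 1) * (indicator {0<..} x *\<^sub>R gamma_kernel w (of_real c) x)" for x
  proof (cases "x > 0")
    case True
    then show ?thesis using assms(2)
      by (simp add: gamma_kernel_def ln_mult powr_def Ln_of_real exp_add [symmetric] algebra_simps)
  next
    case False
    then have "\<not> c * x > 0" using assms(2) by (simp add: zero_less_mult_iff)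
    with False show ?thesis by simp
  qed
  have "has_bochner_integral lborel (\<lambda>x. of_real c powr (1 - w) * (of_real c powr (w - 1) *
           (indicator {0<..} x *\<^sub>R gamma_kernel w (of_real c) x)))
          (of_real c powr (1 - w) * (Gamma w /\<^sub>R c))"
    using * unfolding scale by (rule has_bochner_integral_mult_right)
  moreover have "of_real c powr (1 - w) * (of_real c powr (w - 1) * z) = z" for z
    using assms(2) by (simp add: mult.assoc[symmetric] powr_add[symmetric])
  moreover have "of_real c powr (1 - w) * (Gamma w /\<^sub>R c) = Gamma w * of_real c powr - w"
    using assms(2) by (simp add: powr_diff powr_minus scaleR_conv_of_real field_simps)
  ultimately show ?thesis by (simp add: has_bochner_integral_restrict_space)
qed

lemma has_bochner_integral_norm_gamma_kernel:
  assumes "Re w > 0" "Re v > 0"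
  shows "has_bochner_integral lborel_pos (\<lambda>t. norm (gamma_kernel w v t))
           (Gamma (Re w) * Re v powr - Re w)"
proof -
  have "has_bochner_integral lborel_pos (\<lambda>t. norm (gamma_kernel w v t))
          (Re (Gamma (of_real (Re w)) * of_real (Re v) powr - of_real (Re w)))"
    unfolding norm_gamma_kernel using assms
    by (intro has_bochner_integral_Re has_bochner_integral_gamma_kernel_of_real) auto
  also have "Gamma (of_real (Re w)) * complex_of_real (Re v) powr - of_real (Re w) =
      of_real (Gamma (Re w) * Re v powr - Re w)"
    using assms by (simp add: Gamma_complex_of_real powr_of_real flip: of_real_minus)
  finally show ?thesis by simp
qed

lemma gbinomial_minus_times_power:
  fixes a z :: "'a :: field_char_0"
  shows "(- a gchoose n) * (- z) ^ n = pochhammer a n / fact n * z ^ n"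
  by (simp add: gbinomial_pochhammer power_minus[of z])

lemma neg_binomial_series_complex:
  fixes a z :: complex
  assumes "norm z < 1"
  shows "(\<lambda>n. pochhammer a n / fact n * z ^ n) sums (1 - z) powr - a"
  using gen_binomial_complex[of "-z" "-a"] assms by (simp add: gbinomial_minus_times_power)

lemma neg_binomial_series_real:
  fixes a z :: real
  assumes "\<bar>z\<bar> < 1"
  shows "(\<lambda>n. pochhammer a n / fact n * z ^ n) sums (1 - z) powr - a"
  using gen_binomial_real[of "-z" "-a"] assms by (simp add: gbinomial_minus_times_power)

text \<open>For complex \<open>v\<close>, expand \<open>exp (- v * t)\<close> around a large real point \<open>c\<close>: the disc of radius
  \<open>c\<close> around \<open>c\<close> exhausts the right half-plane, and termwise integration turns the exponential
  series into the binomial series of \<open>(v / c) powr - w\<close>.\<close>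

lemma has_bochner_integral_gamma_kernel:
  assumes w: "Re w > 0" and v: "Re v > 0"
  shows "has_bochner_integral lborel_pos (gamma_kernel w v) (Gamma w * v powr - w)"
proof -
  \<comment> \<open>With this choice \<open>c * Re v\<close> is the square of \<open>norm v\<close>,
    so the squared distance from \<open>c\<close> to \<open>v\<close> is
    \<open>c ^ 2 - norm v ^ 2\<close>, which is below \<open>c ^ 2\<close>.\<close>
  define c where "c = (norm v)\<^sup>2 / Re v"
  have [simp]: "v \<noteq> 0" using v by auto
  have c: "c > 0" using v by (simp add: c_def)
  have "(norm (of_real c - v))\<^sup>2 = c\<^sup>2 - 2 * c * Re v + (norm v)\<^sup>2"
    unfolding cmod_power2 by (simp add: power2_eq_square algebra_simps)
  also have "\<dots> = c\<^sup>2 - (norm v)\<^sup>2"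
    using v by (simp add: c_def)
  also have "\<dots> < c\<^sup>2" by simp
  finally have near: "norm (of_real c - v) < c"
    using c by (simp add: power2_less_imp_less)
  define z where "z = (of_real c - v) / of_real c"
  have z: "norm z < 1"
    using near c by (simp add: z_def norm_divide)
  \<comment> \<open>The \<open>n\<close>-th term of the expansion. The factor \<open>t ^ n\<close>
    is absorbed by passing from \<open>w\<close> to \<open>w + n\<close>, so each term is again a
    kernel with the real parameter \<open>c\<close>.\<close>
  define f where "f = (\<lambda>n t. (of_real c - v) ^ n / fact n * gamma_kernel (w + of_nat n) (of_real c) t)"
  have f_int: "has_bochner_integral lborel_pos (f n)
      (Gamma w * of_real c powr - w * (pochhammer w n / fact n * z ^ n))" for n
  proof -
    have "has_bochner_integral lborel_pos (f n) 
      ((of_real c - v) ^ n / fact n * (Gamma (w + of_nat n) * of_real c powr - (w + of_nat n)))"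
      unfolding f_def using w c
      by (intro has_bochner_integral_mult_right has_bochner_integral_gamma_kernel_of_real) auto
    also have "Gamma (w + of_nat n) = pochhammer w n * Gamma w"
      using not_nonpos_Int[OF w] by (simp add: pochhammer_Gamma Gamma_eq_zero_iff)
    also have "of_real c powr - (w + of_nat n) = of_real c powr - w / of_real c ^ n"
      using c by (simp add: powr_diff powr_nat)
    finally show ?thesis by (simp add: z_def power_divide mult_ac)
  qed
  have f_norm: "(\<integral>t. norm (f n t) \<partial>lborel_pos) =
     Gamma (Re w) * c powr - Re w * (pochhammer (Re w) n / fact n * norm z ^ n)" for n
  proof -
    have "has_bochner_integral lborel_pos (\<lambda>t. norm ((of_real c - v) ^ n / fact n) *
        norm (gamma_kernel (w + of_nat n) (of_real c) t))
       (norm ((of_real c - v) ^ n / fact n) * (Gamma (Re w + n) * c powr - (Re w + n)))"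
      using has_bochner_integral_norm_gamma_kernel[of "w + of_nat n" "of_real c"] w c
      by (intro has_bochner_integral_mult_right) auto
    then have "(\<integral>t. norm (f n t) \<partial>lborel_pos) =
       norm ((of_real c - v) ^ n / fact n) * (Gamma (Re w + n) * c powr - (Re w + n))"
      unfolding f_def norm_mult by (rule has_bochner_integral_integral_eq)
    also have "Gamma (Re w + n) = pochhammer (Re w) n * Gamma (Re w)"
      using w by (subst pochhammer_Gamma) (auto simp: Gamma_eq_zero_iff elim!: nonpos_Ints_cases)
    also have "c powr - (Re w + n) = c powr - Re w / c ^ n"
      using c by (simp add: powr_diff powr_realpow)
    finally show ?thesis
      using c by (simp add: z_def norm_divide norm_power power_divide mult_ac)
  qed
  have f_exp: "f n t = gamma_kernel w (of_real c) t * (((of_real c - v) * of_real t) ^ n / fact n)"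
    if "t > 0" for n t
    using that by (simp add: f_def gamma_kernel_shift power_mult_distrib)
  have f_abs: "summable (\<lambda>n. norm (f n t))" if "t > 0" for t
  proof -
    have "summable (\<lambda>n. norm (gamma_kernel w (of_real c) t) *
        norm (((of_real c - v) * of_real t) ^ n /\<^sub>R fact n))"
      by (intro summable_mult summable_norm_exp)
    then show ?thesis
      using that by (simp add: f_exp norm_mult norm_divide norm_inverse divide_inverse_commute)
  qed
  have f_sum: "(\<Sum>n. f n t) = gamma_kernel w v t" if "t > 0" for t
  proof -
    have "(\<lambda>n. ((of_real c - v) * of_real t) ^ n / fact n) sums exp ((of_real c - v) * of_real t)"
      using exp_converges[of "(of_real c - v) * of_real t"] by (simp add: scaleR_conv_of_real divide_inverse_commute)
    from sums_mult[OF this, of "gamma_kernel w (of_real c) t"]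
    have "(\<lambda>n. f n t) sums (gamma_kernel w (of_real c) t * exp ((of_real c - v) * of_real t))"
      using that by (simp add: f_exp)
    also have "gamma_kernel w (of_real c) t * exp ((of_real c - v) * of_real t) = gamma_kernel w v t"
      using gamma_kernel_add[of w "of_real c" "v - of_real c" t] by simp
    finally show ?thesis by (simp add: sums_iff)
  qed
  have summ_int: "summable (\<lambda>n. \<integral>t. norm (f n t) \<partial>lborel_pos)"
    unfolding f_norm using neg_binomial_series_real[of "norm z" "Re w"] z
    by (intro summable_mult) (auto simp: sums_iff)
  have AE: "AE t in lborel_pos. summable (\<lambda>n. norm (f n t))"
    using f_abs by (intro AE_I2) simp
  have f_integrable: "integrable lborel_pos (f n)" for n
    using f_int by (simp add: has_bochner_integral_iff)
  have "integrable lborel_pos (\<lambda>t. \<Sum>n. f n t)"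
    by (rule integrable_suminf[OF f_integrable AE summ_int])
  also have "?this \<longleftrightarrow> integrable lborel_pos (gamma_kernel w v)"
    by (intro Bochner_Integration.integrable_cong refl) (simp add: f_sum)
  finally have 1: "integrable lborel_pos (gamma_kernel w v)" .
  have "(\<lambda>n. \<integral>t. f n t \<partial>lborel_pos) sums (\<integral>t. (\<Sum>n. f n t) \<partial>lborel_pos)"
    by (rule sums_integral[OF f_integrable AE summ_int])
  also have "(\<integral>t. (\<Sum>n. f n t) \<partial>lborel_pos) = (\<integral>t. gamma_kernel w v t \<partial>lborel_pos)"
    by (intro Bochner_Integration.integral_cong refl) (simp add: f_sum)
  also have "(\<lambda>n. \<integral>t. f n t \<partial>lborel_pos) =
     (\<lambda>n. Gamma w * of_real c powr - w * (pochhammer w n / fact n * z ^ n))"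
    using f_int by (simp add: has_bochner_integral_iff)
  finally have "(\<integral>t. gamma_kernel w v t \<partial>lborel_pos) = Gamma w * of_real c powr - w * (1 - z) powr - w"
    using sums_mult[OF neg_binomial_series_complex[OF z, of w]] sums_unique2 by blast
  also have "1 - z = v / of_real c"
    using c by (simp add: z_def field_simps)
  \<comment> \<open>Division by the positive real \<open>c\<close> merely subtracts
    \<open>ln c\<close> from \<open>Ln v\<close>, so the principal branches match.\<close>
  also have "Gamma w * of_real c powr - w * (v / of_real c) powr - w = Gamma w * v powr - w"
    using c by (simp add: powr_def Ln_divide_of_real Ln_of_real exp_add [symmetric] algebra_simps)
  finally show ?thesis
    using 1 by (simp add: has_bochner_integral_iff)
qed

section \<open>Integral representation and decay of the differences\<close>

text \<open>The maximum over \<open>z\<close> is at \<open>z = \<sigma>\<close>; its factor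
  \<open>exp (- \<sigma>)\<close> is rounded up to 1.\<close>

lemma powr_times_exp_minus_le:
  fixes \<sigma> z :: real
  assumes "\<sigma> > 0" "z > 0"
  shows "z powr \<sigma> * exp (- z) \<le> \<sigma> powr \<sigma>"
proof -
  have "ln (z / \<sigma>) \<le> z / \<sigma> - 1" using assms by (intro ln_le_minus_one) auto
  then have "\<sigma> * ln z - z \<le> \<sigma> * ln \<sigma>"
    using assms by (simp add: ln_div field_simps)
  then show ?thesis
    using assms by (simp add: powr_def exp_add [symmetric])
qed

text \<open>Combines \<open>1 - y \<le> exp (- y)\<close> with the preceding bound at
  \<open>z = Suc m * y\<close>. The factor \<open>exp 1\<close> pays for raising the exponent from
  \<open>m\<close> to \<open>Suc m\<close>, since \<open>y \<le> 1\<close>.\<close>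

lemma powr_times_one_minus_power_le:
  fixes y \<sigma> :: real
  assumes "0 < y" "y \<le> 1" "\<sigma> > 0"
  shows "y powr \<sigma> * (1 - y) ^ m \<le> exp 1 * \<sigma> powr \<sigma> * real (Suc m) powr - \<sigma>"
proof -
  have "(1 - y) ^ m \<le> exp (- y) ^ m"
    using assms exp_ge_add_one_self[of "-y"] by (intro power_mono) auto
  also have "\<dots> = exp y * exp (- (real (Suc m) * y))"
    by (simp add: exp_of_nat_mult [symmetric] exp_add [symmetric] algebra_simps)
  also have "\<dots> \<le> exp 1 * exp (- (real (Suc m) * y))"
    using assms by (intro mult_right_mono) auto
  finally have "y powr \<sigma> * (1 - y) ^ m \<le> y powr \<sigma> * (exp 1 * exp (- (real (Suc m) * y)))"
    by (intro mult_left_mono) auto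
  also have "\<dots> =
      exp 1 * ((real (Suc m) * y) powr \<sigma> * exp (- (real (Suc m) * y))) * real (Suc m) powr - \<sigma>"
    using assms by (simp add: powr_mult powr_minus)
  also have "\<dots> \<le> exp 1 * \<sigma> powr \<sigma> * real (Suc m) powr - \<sigma>"
    using assms by (intro mult_left_mono mult_right_mono powr_times_exp_minus_le) auto
  finally show ?thesis .
qed

definition hurwitz_diff :: "nat \<Rightarrow> complex \<Rightarrow> complex \<Rightarrow> complex" where
  "hurwitz_diff m w v = alt_binomial_sum m (\<lambda>l. (of_nat l + v) powr - w)"

text \<open>The power is expanded binomially, and each \<open>exp (- l * t)\<close> shifts the
  parameter \<open>v\<close> by \<open>l\<close>.\<close>

lemma has_bochner_integral_hurwitz_diff:
  assumes "Re w > 0" "Re v > 0"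
  shows "has_bochner_integral lborel_pos (\<lambda>t. gamma_kernel w v t * of_real ((1 - exp (- t)) ^ m))
           (Gamma w * hurwitz_diff m w v)"
proof -
  have "gamma_kernel w v t * of_real ((1 - exp (- t)) ^ m) =
     (\<Sum>l\<le>m. (-1) ^ l * of_nat (m choose l) * gamma_kernel w (of_nat l + v) t)" for t
  proof -
    have "of_real (1 - exp (- t)) = (- exp (- of_real t) + 1 :: complex)"
      by (simp flip: exp_of_real)
    then have "of_real ((1 - exp (- t)) ^ m) = (- exp (- of_real t) + 1 :: complex) ^ m"
      by (simp only: of_real_power)
    also have "\<dots> = (\<Sum>l\<le>m. (-1) ^ l * of_nat (m choose l) * exp (- of_nat l * of_real t))"
      by (subst binomial_ring)
         (auto intro!: sum.cong simp: power_minus[of "exp _"] exp_of_nat_mult[symmetric])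
    finally show ?thesis
      by (simp add: sum_distrib_left gamma_kernel_add add.commute[of _ v] mult_ac)
  qed
  moreover have "has_bochner_integral lborel_pos
      (\<lambda>t. \<Sum>l\<le>m. (-1) ^ l * of_nat (m choose l) * gamma_kernel w (of_nat l + v) t)
      (\<Sum>l\<le>m. (-1) ^ l * of_nat (m choose l) * (Gamma w * (of_nat l + v) powr - w))"
    using assms by (intro has_bochner_integral_sum has_bochner_integral_mult_right
        has_bochner_integral_gamma_kernel) auto
  ultimately show ?thesis
    by (simp add: hurwitz_diff_def alt_binomial_sum_def sum_distrib_left mult_ac)
qed

text \<open>A factor \<open>exp (- \<sigma> * t)\<close> is split off the kernel and bounded jointly
  with the power, taking \<open>y = exp (- t)\<close>. What remains is the kernel at
  \<open>v - \<sigma>\<close>, integrable because \<open>\<sigma> < Re v\<close>.\<close>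

lemma integral_norm_hurwitz_diff_le:
  assumes "Re w > 0" "0 < \<sigma>" "\<sigma> < Re v"
  shows "(\<integral>t. norm (gamma_kernel w v t * of_real ((1 - exp (- t)) ^ m)) \<partial>lborel_pos) \<le>
           exp 1 * \<sigma> powr \<sigma> * (Gamma (Re w) * (Re v - \<sigma>) powr - Re w) * real (Suc m) powr - \<sigma>"
proof -
  let ?C = "exp 1 * \<sigma> powr \<sigma> * real (Suc m) powr - \<sigma>"
  have I: "has_bochner_integral lborel_pos (\<lambda>t. norm (gamma_kernel w (v - of_real \<sigma>) t))
      (Gamma (Re w) * (Re v - \<sigma>) powr - Re w)"
    using has_bochner_integral_norm_gamma_kernel[of w "v - of_real \<sigma>"] assms by simp
  have "(\<integral>t. norm (gamma_kernel w v t * of_real ((1 - exp (- t)) ^ m)) \<partial>lborel_pos) \<le>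
        (\<integral>t. ?C * norm (gamma_kernel w (v - of_real \<sigma>) t) \<partial>lborel_pos)"
  proof (rule integral_mono)
    show "integrable lborel_pos (\<lambda>t. norm (gamma_kernel w v t * of_real ((1 - exp (- t)) ^ m)))"
      using has_bochner_integral_hurwitz_diff[of w v m] assms
      by (intro integrable_norm) (simp add: has_bochner_integral_iff)
    show "integrable lborel_pos (\<lambda>t. ?C * norm (gamma_kernel w (v - of_real \<sigma>) t))"
      using I by (intro integrable_mult_right) (simp add: has_bochner_integral_iff)
    fix t assume "t \<in> space lborel_pos"
    hence t: "t > 0" by simp
    have "norm (gamma_kernel w v t) = norm (gamma_kernel w (v - of_real \<sigma>) t) * exp (- t) powr \<sigma>"
      using gamma_kernel_add[of w "v - of_real \<sigma>" "of_real \<sigma>" t]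
      by (simp add: norm_mult powr_def)
    hence "norm (gamma_kernel w v t * of_real ((1 - exp (- t)) ^ m)) =
        norm (gamma_kernel w (v - of_real \<sigma>) t) * (exp (- t) powr \<sigma> * (1 - exp (- t)) ^ m)"
      unfolding norm_mult[of "gamma_kernel w v t"] norm_of_real using t by simp
    also have "\<dots> \<le> norm (gamma_kernel w (v - of_real \<sigma>) t) * ?C"
      using t assms by (intro mult_left_mono powr_times_one_minus_power_le) auto
    finally show "norm (gamma_kernel w v t * of_real ((1 - exp (- t)) ^ m)) \<le>
        ?C * norm (gamma_kernel w (v - of_real \<sigma>) t)" by (simp add: mult_ac)
  qed
  also have "\<dots> = ?C * (Gamma (Re w) * (Re v - \<sigma>) powr - Re w)"
    using I by (simp add: has_bochner_integral_iff)
  finally show ?thesis by (simp add: mult_ac)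
qed

text \<open>Dividing the integral estimate by \<open>Gamma w\<close> leaves a constant that is
  continuous in \<open>w\<close>, hence bounded on a compact set. The condition
  \<open>Re w \<ge> 1\<close> keeps \<open>Gamma (Re w)\<close> away from its pole at 0.\<close>

lemma hurwitz_diff_bound_aux:
  assumes "0 < \<sigma>" "\<sigma> < Re v"
  shows "\<exists>C. \<forall>w m. Re w \<ge> 1 \<longrightarrow> norm w \<le> R \<longrightarrow>
           norm (hurwitz_diff m w v) \<le> C * real (Suc m) powr - \<sigma>"
proof -
  define K where "K = {w. Re w \<ge> 1} \<inter> cball (0::complex) R"
  define g where "g = (\<lambda>w. rGamma w * of_real (exp 1 * \<sigma> powr \<sigma> * (Gamma (Re w) * (Re v - \<sigma>) powr - Re w)))"
  have "compact K"
    unfolding K_def by (intro closed_Int_compact closed_halfspace_Re_ge compact_cball)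
  moreover have "continuous_on K (\<lambda>w. Gamma (Re w))"
    by (rule continuous_on_compose2[OF continuous_on_Gamma[of "{1..}"]])
       (auto intro!: continuous_intros elim!: nonpos_Ints_cases simp: K_def)
  then have "continuous_on K g"
    unfolding g_def using assms by (intro continuous_intros) auto
  ultimately have "bounded (g ` K)"
    by (intro compact_imp_bounded compact_continuous_image)
  then obtain C where C: "norm (g w) \<le> C" if "w \<in> K" for w
    unfolding bounded_iff by blast
  have "norm (hurwitz_diff m w v) \<le> C * real (Suc m) powr - \<sigma>" if w: "Re w \<ge> 1" "norm w \<le> R" for w m
  proof -
    let ?B = "exp 1 * \<sigma> powr \<sigma> * (Gamma (Re w) * (Re v - \<sigma>) powr - Re w)"
    have nz: "Gamma w \<noteq> 0" using not_nonpos_Int[of w] w by (simp add: Gamma_eq_zero_iff)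
    have "norm (hurwitz_diff m w v) = norm (rGamma w) * norm (Gamma w * hurwitz_diff m w v)"
      using nz by (simp add: rGamma_inverse_Gamma norm_mult norm_inverse)
    also have "norm (Gamma w * hurwitz_diff m w v) =
          norm (\<integral>t. gamma_kernel w v t * of_real ((1 - exp (- t)) ^ m) \<partial>lborel_pos)"
      using has_bochner_integral_hurwitz_diff[of w v m] w assms
      by (simp add: has_bochner_integral_iff)
    also have "norm (rGamma w) * \<dots> \<le> norm (rGamma w) * (?B * real (Suc m) powr - \<sigma>)"
      using w assms by (intro mult_left_mono order.trans[OF integral_norm_bound]
          integral_norm_hurwitz_diff_le) auto
    also have "\<dots> = norm (g w) * real (Suc m) powr - \<sigma>"
    proof -
      have "Gamma (Re w) \<ge> 0" using w by (intro less_imp_le Gamma_real_pos) auto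
      then show ?thesis by (simp add: g_def norm_mult)
    qed
    also have "\<dots> \<le> C * real (Suc m) powr - \<sigma>"
      using w by (intro mult_right_mono C) (auto simp: K_def)
    finally show ?thesis .
  qed
  then show ?thesis by blast
qed

lemma of_nat_add_neq_0: "Re v > 0 \<Longrightarrow> of_nat l + v \<noteq> 0"
  by (auto simp: complex_eq_iff)

text \<open>One factor \<open>l + v\<close> is taken out of the power and removed by
  \<open>alt_binomial_sum_times_affine\<close>. This expresses the differences at \<open>w\<close>
  by those at \<open>w + 1\<close>, one unit further right.\<close>

lemma hurwitz_diff_recurrence:
  assumes "Re v > 0"
  shows "hurwitz_diff (Suc m) w v =
     v * hurwitz_diff (Suc m) (w + 1) v - of_nat (Suc m) * hurwitz_diff m (w + 1) (v + 1)"
proof -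
  have "(of_nat l + v) powr - w = (of_nat l + v) * (of_nat l + v) powr - (w + 1)" for l
    using of_nat_add_neq_0[OF assms, of l] by (simp add: powr_diff)
  then show ?thesis
    using alt_binomial_sum_times_affine[of m v "\<lambda>l. (of_nat l + v) powr - (w + 1)"]
    by (simp add: hurwitz_diff_def add_ac)
qed

text \<open>The factor \<open>m\<close> in the recurrence is compensated by the better decay at \<open>v + 1\<close>, so the
  bound propagates from the half-plane \<open>Re w \<ge> 1\<close> to the left.\<close>

lemma hurwitz_diff_bound_halfplane:
  assumes "0 < \<sigma>" "\<sigma> < Re v"
  shows "\<exists>C. \<forall>w m. Re w \<ge> 1 - real N \<longrightarrow> norm w \<le> R \<longrightarrow>
           norm (hurwitz_diff m w v) \<le> C * real (Suc m) powr - \<sigma>"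
  using assms
proof (induction N arbitrary: v \<sigma> R)
  case 0
  then show ?case using hurwitz_diff_bound_aux[of \<sigma> v R] by simp
next
  case (Suc N)
  \<comment> \<open>The radius \<open>R + 1\<close> makes room for the shift from \<open>w\<close>
    to \<open>w + 1\<close>.\<close>
  obtain C1 where C1: "norm (hurwitz_diff m w v) \<le> C1 * real (Suc m) powr - \<sigma>"
    if "Re w \<ge> 1 - real N" "norm w \<le> R + 1" for w m
    using Suc.IH[of \<sigma> v "R + 1"] Suc.prems by blast
  obtain C2 where C2: "norm (hurwitz_diff m w (v + 1)) \<le> C2 * real (Suc m) powr - (\<sigma> + 1)"
    if "Re w \<ge> 1 - real N" "norm w \<le> R + 1" for w m
    using Suc.IH[of "\<sigma> + 1" "v + 1" "R + 1"] Suc.prems by auto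
  have "bounded ((\<lambda>w. v powr - w) ` cball 0 R)"
    using Suc.prems by (intro compact_imp_bounded compact_continuous_image continuous_intros) auto
  then obtain C0 where "\<forall>w\<in>cball 0 R. norm (v powr - w) \<le> C0"
    by (auto simp: bounded_iff)
  then have C0: "norm (v powr - w) \<le> C0" if "norm w \<le> R" for w
    using that by simp
  \<comment> \<open>\<open>C0\<close> serves \<open>m = 0\<close>, where the recurrence does not
    apply; the other entry comes from the recurrence. For \<open>m = Suc n\<close> the power of 2
    arises from \<open>m \<ge> Suc m / 2\<close>.\<close>
  define C where "C = max C0 (norm v * C1 + \<bar>C2\<bar> * 2 powr (\<sigma> + 1))"
  have "norm (hurwitz_diff m w v) \<le> C * real (Suc m) powr - \<sigma>"
    if w: "Re w \<ge> 1 - real (Suc N)" "norm w \<le> R" for w m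
  proof (cases m)
    case 0
    then show ?thesis using C0[OF w(2)] by (simp add: hurwitz_diff_def C_def le_max_iff_disj)
  next
    case [simp]: (Suc n)
    have w': "Re (w + 1) \<ge> 1 - real N" "norm (w + 1) \<le> R + 1"
      using w norm_triangle_ineq[of w 1] by auto
    have "real (Suc n) powr - (\<sigma> + 1) \<le> (real (Suc m) / 2) powr - (\<sigma> + 1)"
      using Suc.prems by (intro powr_mono2') auto
    also have "\<dots> = 2 powr (\<sigma> + 1) * real (Suc m) powr - (\<sigma> + 1)"
      unfolding powr_minus by (simp add: powr_divide field_simps)
    finally have *: "real (Suc n) powr - (\<sigma> + 1) \<le> 2 powr (\<sigma> + 1) * real (Suc m) powr - (\<sigma> + 1)" .
    have "norm (hurwitz_diff m w v) \<le>
       norm v * norm (hurwitz_diff m (w + 1) v) + real m * norm (hurwitz_diff n (w + 1) (v + 1))"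
      using Suc.prems norm_triangle_ineq4[of "v * hurwitz_diff m (w + 1) v"
          "of_nat m * hurwitz_diff n (w + 1) (v + 1)"]
      unfolding Suc by (subst hurwitz_diff_recurrence) (auto simp: norm_mult simp del: of_nat_Suc)
    also have "\<dots> \<le> norm v * (C1 * real (Suc m) powr - \<sigma>) +
       real (Suc m) * (\<bar>C2\<bar> * (2 powr (\<sigma> + 1) * real (Suc m) powr - (\<sigma> + 1)))"
    proof (intro add_mono mult_mono)
      have "norm (hurwitz_diff n (w + 1) (v + 1)) \<le> C2 * real (Suc n) powr - (\<sigma> + 1)"
        by (rule C2[OF w'])
      also have "\<dots> \<le> \<bar>C2\<bar> * (2 powr (\<sigma> + 1) * real (Suc m) powr - (\<sigma> + 1))"
        using * by (intro mult_mono) auto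
      finally show "norm (hurwitz_diff n (w + 1) (v + 1)) \<le>
           \<bar>C2\<bar> * (2 powr (\<sigma> + 1) * real (Suc m) powr - (\<sigma> + 1))" .
    qed (use C1[OF w', of m] in auto)
    also have "\<dots> = norm v * (C1 * real (Suc m) powr - \<sigma>) +
       \<bar>C2\<bar> * (2 powr (\<sigma> + 1) * (real (Suc m) * real (Suc m) powr - (\<sigma> + 1)))"
      by (simp only: mult_ac)
    also have "real (Suc m) * real (Suc m) powr - (\<sigma> + 1) = real (Suc m) powr - \<sigma>"
      by (subst powr_mult_base) auto
    also have "norm v * (C1 * real (Suc m) powr - \<sigma>) + \<bar>C2\<bar> * (2 powr (\<sigma> + 1) * real (Suc m) powr - \<sigma>) =
       (norm v * C1 + \<bar>C2\<bar> * 2 powr (\<sigma> + 1)) * real (Suc m) powr - \<sigma>"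
      by (simp only: ring_distribs mult.assoc)
    also have "\<dots> \<le> C * real (Suc m) powr - \<sigma>"
      by (intro mult_right_mono) (auto simp: C_def)
    finally show ?thesis .
  qed
  then show ?case by blast
qed

text \<open>The ball of radius \<open>R\<close> lies in the half-plane
  \<open>Re w \<ge> 1 - N\<close> as soon as \<open>N \<ge> R + 1\<close>.\<close>

lemma hurwitz_diff_bound:
  assumes "0 < \<sigma>" "\<sigma> < Re v"
  obtains C where "\<And>w m. norm w \<le> R \<Longrightarrow> norm (hurwitz_diff m w v) \<le> C * real (Suc m) powr - \<sigma>"
proof -
  obtain N :: nat where N: "R + 1 \<le> real N" using real_arch_simple by blast
  obtain C where C: "norm (hurwitz_diff m w v) \<le> C * real (Suc m) powr - \<sigma>"
    if "Re w \<ge> 1 - real N" "norm w \<le> R" for w m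
    using hurwitz_diff_bound_halfplane[OF assms, of N R] by blast
  show ?thesis
  proof (rule that[OF C])
    fix w :: complex assume "norm w \<le> R"
    then show "Re w \<ge> 1 - real N" using abs_Re_le_cmod[of w] N by linarith
  qed
qed

section \<open>Size and generating function of the Stirling weights\<close>

lemma harm_le_ln: "harm n \<le> 1 + ln (real (Suc n))"
proof -
  have Suc_case: "harm (Suc n) \<le> 1 + ln (real (Suc n))" for n
  proof (induction n)
    case 0
    show ?case by (simp add: harm_def)
  next
    case (Suc n)
    \<comment> \<open>Bounds the next harmonic term by a difference of logarithms, which
      telescopes.\<close>
    have "ln (real (Suc n) / real (Suc (Suc n))) \<le> real (Suc n) / real (Suc (Suc n)) - 1"
      by (intro ln_le_minus_one) auto
    also have "\<dots> = - inverse (real (Suc (Suc n)))"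
      by (simp add: field_simps)
    finally have "inverse (real (Suc (Suc n))) \<le> ln (real (Suc (Suc n))) - ln (real (Suc n))"
      by (simp add: ln_div)
    with Suc show ?case by (simp only: harm_Suc[of "Suc n"])
  qed
  have "harm n \<le> (harm (Suc n) :: real)" by (rule harm_mono) simp
  also note Suc_case
  finally show ?thesis .
qed

text \<open>Here \<open>j\<close> stands for \<open>k - 1\<close>: this excludes
  \<open>k = 0\<close> and makes \<open>n + j\<close> the order of the accompanying difference
  without truncated subtraction.\<close>

definition stirling_weight :: "nat \<Rightarrow> nat \<Rightarrow> real" where
  "stirling_weight j n = real (stirling (Suc (n + j)) (Suc j)) / fact (Suc (n + j))"

lemma stirling_weight_nonneg: "stirling_weight j n \<ge> 0"
  by (simp add: stirling_weight_def)

text \<open>The weight is at most \<open>harm (n + j) ^ j / (n + j + 1)\<close>, and any power of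
  the harmonic numbers is beaten by an arbitrarily small power of the index.\<close>

lemma summable_stirling_weight:
  assumes "\<sigma> > 0"
  shows "summable (\<lambda>n. stirling_weight j n * real (Suc (n + j)) powr - \<sigma>)"
proof -
  \<comment> \<open>Chosen so that \<open>j * \<epsilon> \<le> \<sigma> / 2\<close>: half of the
    decay is spent on the harmonic numbers, the other half on convergence. \<open>Suc j\<close>
    keeps the quotient meaningful for \<open>j = 0\<close>.\<close>
  define \<epsilon> where "\<epsilon> = \<sigma> / (2 * real (Suc j))"
  define C where "C = 1 + 1 / \<epsilon>"
  have \<epsilon>: "\<epsilon> > 0" using assms by (simp add: \<epsilon>_def)
  have harm_le: "harm N \<le> C * real (Suc N) powr \<epsilon>" for N
  proof -
    have "\<epsilon> * ln (real (Suc N)) = ln (real (Suc N) powr \<epsilon>)" by (simp add: ln_powr)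
    also have "\<dots> \<le> real (Suc N) powr \<epsilon>" 
      using ln_le_minus_one[of "real (Suc N) powr \<epsilon>"] by simp
    finally have "ln (real (Suc N)) \<le> 1 / \<epsilon> * real (Suc N) powr \<epsilon>"
      using \<epsilon> by (simp add: field_simps)
    moreover have "1 \<le> real (Suc N) powr \<epsilon>" using \<epsilon> by (intro ge_one_powr_ge_zero) auto
    ultimately show ?thesis using harm_le_ln[of N] by (simp only: C_def ring_distribs)
  qed
  have bound: "stirling_weight j n * real (Suc (n + j)) powr - \<sigma> \<le>
               C ^ j * real (n + Suc j) powr (- 1 - \<sigma> / 2)" for n
  proof -
    let ?x = "real (Suc (n + j))"
    have "stirling_weight j n = (real (stirling (Suc (n + j)) (Suc j)) / fact (n + j)) * ?x powr - 1"
      by (simp add: stirling_weight_def powr_minus field_simps del: stirling.simps of_nat_Suc)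
    also have "\<dots> \<le> (C * ?x powr \<epsilon>) ^ j * ?x powr - 1"
      by (intro mult_right_mono order.trans[OF stirling_Suc_Suc_le_harm_power] power_mono
          harm_le harm_nonneg) auto
    also have "\<dots> = C ^ j * ?x powr (real j * \<epsilon> - 1)"
      by (simp add: power_mult_distrib powr_diff powr_minus powr_power mult_ac divide_inverse)
    finally have "stirling_weight j n * ?x powr - \<sigma> \<le>
          C ^ j * ?x powr (real j * \<epsilon> - 1) * ?x powr - \<sigma>"
      by (intro mult_right_mono) auto
    also have "\<dots> = C ^ j * ?x powr (real j * \<epsilon> - 1 - \<sigma>)"
      by (simp add: powr_diff powr_minus divide_inverse)
    also have "\<dots> \<le> C ^ j * ?x powr (- 1 - \<sigma> / 2)"
    proof (intro mult_left_mono powr_mono)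
      have "real j * \<epsilon> \<le> \<sigma> / 2" using assms by (simp add: \<epsilon>_def field_simps)
      then show "real j * \<epsilon> - 1 - \<sigma> \<le> - 1 - \<sigma> / 2" by simp
    qed (use \<epsilon> in \<open>auto simp: C_def\<close>)
    finally show ?thesis by simp
  qed
  have "summable (\<lambda>n. C ^ j * real (n + Suc j) powr (- 1 - \<sigma> / 2))"
    using assms
    by (intro summable_mult summable_ignore_initial_segment[where f = "\<lambda>n. real n powr _"])
       (simp add: summable_real_powr_iff)
  then show ?thesis
    by (rule summable_comparison_test'[of _ 0])
       (use bound stirling_weight_nonneg in \<open>auto simp: abs_mult\<close>)
qed

text \<open>In \<open>stirling_exp_gf\<close> the coefficients below index \<open>Suc j\<close>
  vanish and are dropped. Dividing by \<open>u\<close> then creates the denominator of the Hurwitz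
  integrand.\<close>

lemma stirling_weight_gf:
  assumes "0 < u" "u < 1"
  shows "(\<lambda>n. stirling_weight j n * u ^ (n + j)) sums ((- ln (1 - u)) ^ Suc j / (fact (Suc j) * u))"
proof -
  have "(\<lambda>n. real (stirling (n + Suc j) (Suc j)) / fact (n + Suc j) * u ^ (n + Suc j)) sums
          ((- ln (1 - u)) ^ Suc j / fact (Suc j))"
    using stirling_exp_gf[of u "Suc j"] assms
    by (subst sums_zero_iff_shift) auto
  from sums_divide[OF this, of u] show ?thesis
    using assms by (simp add: stirling_weight_def field_simps del: stirling.simps fact_Suc)
qed

section \<open>Two series expansions of one Mellin integral\<close>

lemma sums_integral_lborel_pos:
  fixes f :: "nat \<Rightarrow> real \<Rightarrow> complex"
  assumes "\<And>n. integrable lborel_pos (f n)"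
    and "\<And>t. t > 0 \<Longrightarrow> summable (\<lambda>n. norm (f n t))"
    and "summable (\<lambda>n. \<integral>t. norm (f n t) \<partial>lborel_pos)"
    and "\<And>t. t > 0 \<Longrightarrow> (\<lambda>n. f n t) sums F t"
  shows "(\<lambda>n. \<integral>t. f n t \<partial>lborel_pos) sums (\<integral>t. F t \<partial>lborel_pos)"
proof -
  have "(\<lambda>n. \<integral>t. f n t \<partial>lborel_pos) sums (\<integral>t. (\<Sum>n. f n t) \<partial>lborel_pos)"
    by (rule sums_integral) (use assms in auto)
  also have "(\<integral>t. (\<Sum>n. f n t) \<partial>lborel_pos) = (\<integral>t. F t \<partial>lborel_pos)"
    by (intro Bochner_Integration.integral_cong refl) (use assms(4) in \<open>simp add: sums_iff\<close>)
  finally show ?thesis .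
qed

text \<open>The denominator is expanded as a geometric series in \<open>exp (- t)\<close>;
  \<open>Re s > 1\<close> makes the integrals of the norms summable.\<close>

lemma Gamma_times_hurwitz_series:
  assumes s: "Re s > 1" and v: "Re v > 0"
  shows "(\<lambda>n. Gamma s * (of_nat n + v) powr - s) sums
           (\<integral>t. gamma_kernel s v t / of_real (1 - exp (- t)) \<partial>lborel_pos)"
proof -
  have int: "has_bochner_integral lborel_pos (gamma_kernel s (of_nat n + v))
          (Gamma s * (of_nat n + v) powr - s)" for n
    using assms by (intro has_bochner_integral_gamma_kernel) auto
  have kernel: "gamma_kernel s (of_nat n + v) t = gamma_kernel s v t * of_real (exp (- t)) ^ n" for n t
  proof -
    have "exp (- of_nat n * of_real t) = complex_of_real (exp (- t)) ^ n"
      by (simp add: exp_of_nat_mult [symmetric] flip: exp_of_real)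
    then show ?thesis by (simp add: gamma_kernel_add add.commute[of _ v])
  qed
  have "(\<lambda>n. \<integral>t. gamma_kernel s (of_nat n + v) t \<partial>lborel_pos) sums
          (\<integral>t. gamma_kernel s v t / of_real (1 - exp (- t)) \<partial>lborel_pos)"
  proof (rule sums_integral_lborel_pos)
    show "integrable lborel_pos (gamma_kernel s (of_nat n + v))" for n
      using int by (simp add: has_bochner_integral_iff)
    show "summable (\<lambda>n. norm (gamma_kernel s (of_nat n + v) t))" if "t > 0" for t
      using that by (simp add: kernel norm_mult norm_power summable_geometric summable_mult)
    show "(\<lambda>n. gamma_kernel s (of_nat n + v) t) sums (gamma_kernel s v t / of_real (1 - exp (- t)))"
      if "t > 0" for t
    proof -
      have "(\<lambda>n. of_real (exp (- t)) ^ n) sums (1 / (1 - complex_of_real (exp (- t))))"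
        using that by (intro geometric_sums) simp
      from sums_mult[OF this, of "gamma_kernel s v t"] show ?thesis by (simp add: kernel)
    qed
    have norm_int: "(\<integral>t. norm (gamma_kernel s (of_nat n + v) t) \<partial>lborel_pos) =
            Gamma (Re s) * (real n + Re v) powr - Re s" for n
      using has_bochner_integral_norm_gamma_kernel[of s "of_nat n + v"] assms
      by (simp add: has_bochner_integral_iff)
    show "summable (\<lambda>n. \<integral>t. norm (gamma_kernel s (of_nat n + v) t) \<partial>lborel_pos)"
      unfolding norm_int
    proof (rule summable_mult, rule summable_comparison_test'[where N = 1])
      show "summable (\<lambda>n. real n powr - Re s)" using s by (simp add: summable_real_powr_iff)
      show "norm ((real n + Re v) powr - Re s) \<le> real n powr - Re s" if "n \<ge> 1" for n
        using that s v by (auto intro!: powr_mono2')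
    qed
  qed
  then show ?thesis
    using int by (simp add: has_bochner_integral_iff)
qed

text \<open>At \<open>u = 1 - exp (- t)\<close> the logarithm in the generating function is
  \<open>- t\<close>. The resulting \<open>t ^ Suc j\<close> raises the kernel parameter from
  \<open>w\<close> to \<open>w + Suc j\<close>, which gives the Hurwitz integral at that
  point.\<close>

lemma Gamma_times_difference_series:
  assumes w: "Re w > 0" and v: "Re v > 0"
  shows "(\<lambda>n. of_real (stirling_weight j n) * (Gamma w * hurwitz_diff (n + j) w v)) sums
     ((\<integral>t. gamma_kernel (w + of_nat (Suc j)) v t / of_real (1 - exp (- t)) \<partial>lborel_pos) / fact (Suc j))"
proof -
  define \<sigma> where "\<sigma> = Re v / 2"
  have \<sigma>: "0 < \<sigma>" "\<sigma> < Re v" using v by (simp_all add: \<sigma>_def)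
  define f where "f = (\<lambda>n t. of_real (stirling_weight j n) *
     (gamma_kernel w v t * of_real ((1 - exp (- t)) ^ (n + j))))"
  have int: "has_bochner_integral lborel_pos (f n)
       (of_real (stirling_weight j n) * (Gamma w * hurwitz_diff (n + j) w v))" for n
    unfolding f_def
    by (intro has_bochner_integral_mult_right has_bochner_integral_hurwitz_diff assms)
  have f_eq: "f n t = gamma_kernel w v t * of_real (stirling_weight j n * (1 - exp (- t)) ^ (n + j))" for n t
    by (simp add: f_def)
  have gf: "(\<lambda>n. stirling_weight j n * (1 - exp (- t)) ^ (n + j)) sums
     (t ^ Suc j / (fact (Suc j) * (1 - exp (- t))))" if "t > 0" for t
    using stirling_weight_gf[of "1 - exp (- t)" j] that by simp
  have "(\<lambda>n. \<integral>t. f n t \<partial>lborel_pos) sums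
     (\<integral>t. gamma_kernel (w + of_nat (Suc j)) v t / of_real (1 - exp (- t)) / fact (Suc j) \<partial>lborel_pos)"
  proof (rule sums_integral_lborel_pos)
    show "integrable lborel_pos (f n)" for n
      using int by (simp add: has_bochner_integral_iff)
    show "summable (\<lambda>n. norm (f n t))" if "t > 0" for t
      unfolding f_eq norm_mult norm_of_real
      using gf[OF that] that
      by (intro summable_mult) (simp add: abs_mult stirling_weight_nonneg sums_iff)
    show "(\<lambda>n. f n t) sums
        (gamma_kernel (w + of_nat (Suc j)) v t / of_real (1 - exp (- t)) / fact (Suc j))"
      if "t > 0" for t
    proof -
      have "(\<lambda>n. f n t) sums
        (gamma_kernel w v t * of_real (t ^ Suc j / (fact (Suc j) * (1 - exp (- t)))))"
        unfolding f_eq by (intro sums_mult sums_of_real gf that)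
      then show ?thesis
        unfolding gamma_kernel_shift[OF that] by (simp add: field_simps)
    qed
    let ?B = "exp 1 * \<sigma> powr \<sigma> * (Gamma (Re w) * (Re v - \<sigma>) powr - Re w)"
    have "norm (\<integral>t. norm (f n t) \<partial>lborel_pos) \<le>
        ?B * (stirling_weight j n * real (Suc (n + j)) powr - \<sigma>)" for n
    proof -
      have "norm (\<integral>t. norm (f n t) \<partial>lborel_pos) = stirling_weight j n *
         (\<integral>t. norm (gamma_kernel w v t * of_real ((1 - exp (- t)) ^ (n + j))) \<partial>lborel_pos)"
        unfolding f_def norm_mult[of "of_real (stirling_weight j n)"]
        by (simp add: stirling_weight_nonneg abs_mult)
      also have "\<dots> \<le> stirling_weight j n * (?B * real (Suc (n + j)) powr - \<sigma>)"
        using w \<sigma> by (intro mult_left_mono integral_norm_hurwitz_diff_le stirling_weight_nonneg) auto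
      finally show ?thesis by (simp only: mult_ac)
    qed
    then show "summable (\<lambda>n. \<integral>t. norm (f n t) \<partial>lborel_pos)"
      using summable_mult[OF summable_stirling_weight[OF \<sigma>(1)], of ?B j]
      by (rule summable_comparison_test'[rotated, where N = 0])
  qed
  then show ?thesis
    unfolding integral_divide_zero has_bochner_integral_integral_eq[OF int] .
qed

section \<open>The difference series as an entire function\<close>

definition difference_series :: "nat \<Rightarrow> complex \<Rightarrow> complex \<Rightarrow> complex" where
  "difference_series j w v = (\<Sum>n. of_real (stirling_weight j n) * hurwitz_diff (n + j) w v)"

text \<open>The decay of the differences is uniform on the ball and the weights are summable against
  it. The majorant gives both pointwise convergence and the Weierstrass test.\<close>

lemma difference_series_majorant:
  assumes "Re v > 0"
  obtains M where "summable M"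
    "\<And>w n. norm w \<le> R \<Longrightarrow> norm (of_real (stirling_weight j n) * hurwitz_diff (n + j) w v) \<le> M n"
proof -
  define \<sigma> where "\<sigma> = Re v / 2"
  have \<sigma>: "0 < \<sigma>" "\<sigma> < Re v" using assms by (simp_all add: \<sigma>_def)
  obtain C where C: "norm w \<le> R \<Longrightarrow> norm (hurwitz_diff m w v) \<le> C * real (Suc m) powr - \<sigma>" for w m
    using hurwitz_diff_bound[OF \<sigma>, where R = R] by blast
  show ?thesis
  proof (rule that)
    show "summable (\<lambda>n. C * (stirling_weight j n * real (Suc (n + j)) powr - \<sigma>))"
      by (intro summable_mult summable_stirling_weight \<sigma>)
    fix w :: complex and n assume "norm w \<le> R"
    then have "stirling_weight j n * norm (hurwitz_diff (n + j) w v) \<le>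
        stirling_weight j n * (C * real (Suc (n + j)) powr - \<sigma>)"
      by (intro mult_left_mono C stirling_weight_nonneg)
    then show "norm (of_real (stirling_weight j n) * hurwitz_diff (n + j) w v) \<le>
        C * (stirling_weight j n * real (Suc (n + j)) powr - \<sigma>)"
      by (simp add: norm_mult stirling_weight_nonneg mult_ac)
  qed
qed

lemma difference_series_sums:
  assumes "Re v > 0"
  shows "(\<lambda>n. of_real (stirling_weight j n) * hurwitz_diff (n + j) w v) sums difference_series j w v"
proof -
  obtain M where "summable M"
    "\<And>n. norm (of_real (stirling_weight j n) * hurwitz_diff (n + j) w v) \<le> M n"
    using difference_series_majorant[OF assms, of "norm w" j] by (metis order.refl)
  then have "summable (\<lambda>n. of_real (stirling_weight j n) * hurwitz_diff (n + j) w v)"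
    by (rule summable_comparison_test'[where N = 0])
  then show ?thesis by (simp add: difference_series_def summable_sums)
qed

lemma holomorphic_difference_series:
  assumes "Re v > 0"
  shows "(\<lambda>w. difference_series j w v) holomorphic_on UNIV"
proof (rule holomorphic_uniform_sequence)
  show "(\<lambda>w. \<Sum>n<N. of_real (stirling_weight j n) * hurwitz_diff (n + j) w v) holomorphic_on UNIV" for N
    unfolding hurwitz_diff_def alt_binomial_sum_def
    using of_nat_add_neq_0[OF assms] by (intro holomorphic_intros)
  fix z :: complex
  obtain M where M: "summable M" "\<And>w n. norm w \<le> norm z + 1 \<Longrightarrow>
     norm (of_real (stirling_weight j n) * hurwitz_diff (n + j) w v) \<le> M n"
    using difference_series_majorant[OF assms] by blast
  have "uniform_limit (cball z 1)
     (\<lambda>N w. \<Sum>n<N. of_real (stirling_weight j n) * hurwitz_diff (n + j) w v)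
     (\<lambda>w. difference_series j w v) sequentially"
    unfolding difference_series_def
  proof (rule Weierstrass_m_test[OF _ M(1)])
    fix n and w assume "w \<in> cball z 1"
    then have "norm w \<le> norm z + 1"
      using norm_triangle_ineq2[of w z] by (simp add: dist_norm norm_minus_commute)
    then show "norm (of_real (stirling_weight j n) * hurwitz_diff (n + j) w v) \<le> M n" by (rule M(2))
  qed
  then show "\<exists>d>0. cball z d \<subseteq> UNIV \<and> uniform_limit (cball z d)
     (\<lambda>N w. \<Sum>n<N. of_real (stirling_weight j n) * hurwitz_diff (n + j) w v)
     (\<lambda>w. difference_series j w v) sequentially"
    by (intro exI[of _ 1]) auto
qed simp

lemma holomorphic_difference_series_shift:
  assumes "Re v > 0"
  shows "(\<lambda>s. difference_series j (s - c) v) holomorphic_on A"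
proof -
  have "(\<lambda>w. difference_series j w v) \<circ> (\<lambda>s. s - c) holomorphic_on A"
    by (rule holomorphic_on_compose_gen[OF _ holomorphic_difference_series[OF assms]])
       (auto intro!: holomorphic_intros)
  then show ?thesis by (simp add: o_def)
qed

text \<open>For \<open>w = s - Suc j\<close> both expansions evaluate the same integral, and
  \<open>Gamma s / Gamma w\<close> is the rising factorial of \<open>w\<close>.\<close>

lemma hurwitz_series_eq_difference_series:
  assumes s: "Re s > real (Suc j)" and v: "Re v > 0"
  shows "(\<lambda>n. 1 / (of_nat n + v) powr s) sums
     (fact (Suc j) / pochhammer (s - of_nat (Suc j)) (Suc j) * difference_series j (s - of_nat (Suc j)) v)"
proof -
  define w where "w = s - of_nat (Suc j)"
  define I where "I = (\<integral>t. gamma_kernel s v t / of_real (1 - exp (- t)) \<partial>lborel_pos)"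
  have w: "Re w > 0" and s1: "Re s > 1" using s by (simp_all add: w_def)
  have sw: "s = w + of_nat (Suc j)" by (simp add: w_def)
  have nz: "Gamma s \<noteq> 0" "Gamma w \<noteq> 0"
    using not_nonpos_Int[of s] not_nonpos_Int[of w] w s1 by (simp_all add: Gamma_eq_zero_iff)
  have poch: "pochhammer w (Suc j) = Gamma s / Gamma w"
    unfolding sw by (intro pochhammer_Gamma not_nonpos_Int w)
  have "(\<lambda>n. Gamma w * (of_real (stirling_weight j n) * hurwitz_diff (n + j) w v)) sums (I / fact (Suc j))"
    using Gamma_times_difference_series[OF w v, of j] unfolding I_def sw by (simp add: mult_ac)
  moreover have "(\<lambda>n. Gamma w * (of_real (stirling_weight j n) * hurwitz_diff (n + j) w v)) sums
     (Gamma w * difference_series j w v)"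
    by (intro sums_mult difference_series_sums v)
  ultimately have "I / fact (Suc j) = Gamma w * difference_series j w v"
    by (rule sums_unique2)
  then have I: "I = fact (Suc j) * (Gamma w * difference_series j w v)"
    by (simp add: field_simps del: fact_Suc)
  have "(\<lambda>n. Gamma s * (of_nat n + v) powr - s / Gamma s) sums (I / Gamma s)"
    unfolding I_def by (intro sums_divide Gamma_times_hurwitz_series s1 v)
  also have "(\<lambda>n. Gamma s * (of_nat n + v) powr - s / Gamma s) = (\<lambda>n. 1 / (of_nat n + v) powr s)"
    using nz by (simp add: powr_minus inverse_eq_divide)
  also have "I / Gamma s = fact (Suc j) / pochhammer w (Suc j) * difference_series j w v"
    using nz by (simp add: I poch)
  finally show ?thesis by (simp only: w_def)
qed

section \<open>Analytic continuation in \<open>s\<close>\<close>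

text \<open>Shows that the definite description in \<open>hurwitz_zeta\<close> is proper: the case
  \<open>j = 0\<close> of the difference series supplies a candidate, and the identity theorem on
  the connected set \<open>- {1}\<close> makes it unique.\<close>

lemma
  assumes "Re v > 0"
  shows holomorphic_hurwitz_zeta: "(\<lambda>s. hurwitz_zeta s v) holomorphic_on - {1}" (is ?th1)
    and hurwitz_zeta_sums: "Re s > 1 \<Longrightarrow> (\<lambda>n. 1 / (of_nat n + v) powr s) sums hurwitz_zeta s v"
proof -
  let ?P = "\<lambda>f. f holomorphic_on (- {1}) \<and> f 1 = 0 \<and>
        (\<forall>z. Re z > 1 \<longrightarrow> (\<lambda>n. 1 / (of_nat n + v) powr z) sums f z)"
  \<comment> \<open>The value 0 at the pole agrees with the convention in the definition of
    \<open>hurwitz_zeta\<close>.\<close>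
  define f where "f = (\<lambda>s. if s = 1 then 0 else difference_series 0 (s - 1) v / (s - 1))"
  have "(\<lambda>s. difference_series 0 (s - 1) v / (s - 1)) holomorphic_on - {1}"
    by (intro holomorphic_intros holomorphic_difference_series_shift assms) auto
  then have "f holomorphic_on - {1}"
    by (rule holomorphic_transform) (simp add: f_def)
  moreover have "(\<lambda>n. 1 / (of_nat n + v) powr z) sums f z" if "Re z > 1" for z
    using hurwitz_series_eq_difference_series[of 0 z v] that assms by (auto simp: f_def)
  ultimately have f: "?P f" by (simp add: f_def)
  have uniq: "g = f" if g: "?P g" for g
  proof
    fix z show "g z = f z"
    proof (cases "z = 1")
      case False
      show ?thesis
      proof (rule analytic_continuation_open[of "{z. Re z > 1}" "- {1}" g f])
        show "connected (- {1::complex})"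
          using connected_punctured_universe[of "1::complex"] by simp
        show "{z. Re z > 1} \<noteq> {}"
          by (auto intro!: exI[of _ 2])
        show "g z = f z" if "z \<in> {z. Re z > 1}" for z
          using f g that sums_unique2 by blast
        show "g holomorphic_on - {1}" "f holomorphic_on - {1}" using f g by blast+
      qed (use False in \<open>auto simp: open_halfspace_Re_gt\<close>)
    qed (use f g in metis)
  qed
  have "(THE f. ?P f) = f" by (rule the_equality[where P = ?P, OF f uniq])
  then have eq: "hurwitz_zeta s v = f s" for s by (simp add: hurwitz_zeta_def)
  show ?th1 "Re s > 1 \<Longrightarrow> (\<lambda>n. 1 / (of_nat n + v) powr s) sums hurwitz_zeta s v"
    unfolding eq using f by blast+
qed

text \<open>With the denominator cleared, both sides are holomorphic on all of \<open>- {1}\<close>,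
  so agreement on a right half-plane spreads by the identity theorem without removing
  \<open>2, ..., Suc j\<close>.\<close>

lemma pochhammer_times_hurwitz_zeta:
  assumes v: "Re v > 0" and s: "s \<noteq> 1"
  shows "pochhammer (s - of_nat (Suc j)) (Suc j) * hurwitz_zeta s v =
           fact (Suc j) * difference_series j (s - of_nat (Suc j)) v"
proof (rule analytic_continuation_open[of "{z. Re z > real (Suc j)}" "- {1}"
      "\<lambda>s. pochhammer (s - of_nat (Suc j)) (Suc j) * hurwitz_zeta s v"
      "\<lambda>s. fact (Suc j) * difference_series j (s - of_nat (Suc j)) v"])
  show "connected (- {1::complex})"
    using connected_punctured_universe[of "1::complex"] by simp
  show "{z. Re z > real (Suc j)} \<noteq> {}"
    by (auto intro!: exI[of _ "of_nat (j + 2)"])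
  show "(\<lambda>s. pochhammer (s - of_nat (Suc j)) (Suc j) * hurwitz_zeta s v) holomorphic_on - {1}"
    unfolding pochhammer_prod by (intro holomorphic_intros holomorphic_hurwitz_zeta v)
  show "(\<lambda>s. fact (Suc j) * difference_series j (s - of_nat (Suc j)) v) holomorphic_on - {1}"
    by (intro holomorphic_intros holomorphic_difference_series_shift v)
  fix z assume z: "z \<in> {z. Re z > real (Suc j)}"
  define w where "w = z - of_nat (Suc j)"
  have w: "Re w > 0" "z = w + of_nat (Suc j)" using z by (auto simp: w_def)
  have "pochhammer w (Suc j) \<noteq> 0"
    using not_nonpos_Int[of w] w not_nonpos_Int[of z] z by (auto simp: pochhammer_Gamma Gamma_eq_zero_iff)
  moreover have "hurwitz_zeta z v = fact (Suc j) / pochhammer w (Suc j) * difference_series j w v"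
    using hurwitz_series_eq_difference_series[of j z v] hurwitz_zeta_sums[of v z] z v sums_unique2
    unfolding w_def by fastforce
  ultimately show "pochhammer (z - of_nat (Suc j)) (Suc j) * hurwitz_zeta z v =
           fact (Suc j) * difference_series j (z - of_nat (Suc j)) v"
    unfolding w_def [symmetric] by simp
qed (use s in \<open>auto simp: open_halfspace_Re_gt\<close>)

section \<open>Closed forms of the weights and the final identities\<close>

lemma stirling_weight_eq_S1:
  "of_int \<bar>S1 (n + Suc j) (Suc j)\<bar> / fact (n + Suc j) = complex_of_real (stirling_weight j n)"
  by (simp add: abs_S1 stirling_weight_def del: stirling.simps fact_Suc)

lemma of_nat_stirling_2: "(of_nat (stirling (Suc n) 2) :: complex) = fact n * harm n"
proof (cases "n = 0")
  case True
  then show ?thesis by (simp add: numeral_2_eq_2 harm_def)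
next
  case False
  then show ?thesis
    using of_nat_stirling_Suc_n_2[of n, where ?'a = complex] by (simp add: harm_def inverse_eq_divide)
qed

text \<open>Divided by \<open>fact n\<close>, this is the second elementary symmetric polynomial in
  \<open>1, 1/2, ..., 1/n\<close>, written through power sums by Newton's identity.\<close>

lemma of_nat_stirling_3:
  "(of_nat (stirling (Suc n) 3) :: complex) = fact n * ((harm n)\<^sup>2 - harm2 n) / 2"
proof (induction n)
  case 0
  show ?case by (simp add: harm_def harm2_def numeral_3_eq_3)
next
  case (Suc n)
  have "stirling (Suc (Suc n)) 3 = Suc n * stirling (Suc n) 3 + stirling (Suc n) 2"
    using stirling.simps(4)[of "Suc n" 2] by (simp only: Suc_numeral semiring_norm)
  then have "of_nat (stirling (Suc (Suc n)) 3) =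
      of_nat (Suc n) * (fact n * ((harm n)\<^sup>2 - harm2 n) / 2) + (fact n * harm n :: complex)"
    by (simp only: of_nat_add of_nat_mult Suc.IH of_nat_stirling_2)
  also have "\<dots> = of_nat (Suc n) * fact n * ((harm n)\<^sup>2 + 2 * harm n / of_nat (Suc n) - harm2 n) / 2"
    by (simp add: field_simps del: of_nat_Suc)
  also have "(harm n)\<^sup>2 + 2 * harm n / of_nat (Suc n) - harm2 n = (harm (Suc n))\<^sup>2 - harm2 (Suc n)"
    by (simp add: harm_Suc harm2_def power2_eq_square inverse_eq_divide algebra_simps del: of_nat_Suc)
  finally show ?case by simp
qed

lemma stirling_weight_1:
  "complex_of_real (stirling_weight 1 n) = harm (n + 1) / of_nat (n + 2)"
proof -
  have "complex_of_real (stirling_weight 1 n) = of_nat (stirling (Suc (n + 1)) 2) / fact (Suc (n + 1))"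
    by (simp add: stirling_weight_def numeral_2_eq_2 del: stirling.simps fact_Suc)
  then show ?thesis unfolding of_nat_stirling_2 by (simp del: of_nat_Suc)
qed

lemma stirling_weight_2:
  "complex_of_real (stirling_weight 2 n) = ((harm (n + 2))\<^sup>2 - harm2 (n + 2)) / (2 * of_nat (n + 3))"
proof -
  have "complex_of_real (stirling_weight 2 n) = of_nat (stirling (Suc (n + 2)) 3) / fact (Suc (n + 2))"
    by (simp add: stirling_weight_def numeral_3_eq_3 numeral_2_eq_2 del: stirling.simps fact_Suc)
  then show ?thesis unfolding of_nat_stirling_3 fact_Suc[of "n + 2"]
    by (simp add: mult_ac del: fact_Suc of_nat_Suc) (simp add: add_ac)
qed

lemma hurwitz_diff_altdef:
  "hurwitz_diff m (s - c) v =
     (\<Sum>l=0..m. (-1) ^ l * of_nat (m choose l) * (of_nat l + v) powr (c - s))"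
  by (simp add: hurwitz_diff_def alt_binomial_sum_def atLeast0AtMost)

text \<open>With \<open>j = k - 1\<close>, splitting the order \<open>n + k - 1\<close> into
  \<open>k - 1\<close> and \<open>n\<close> turns the first form of the series into the
  second.\<close>

lemma hurwitz_diff_add_order:
  "hurwitz_diff (n + j) (s - c) v =
     (\<Sum>r=0..j. (-1) ^ r * of_nat (j choose r) *
        (\<Sum>l=0..n. (-1) ^ l * of_nat (n choose l) * (of_nat l + of_nat r + v) powr (c - s)))"
  unfolding hurwitz_diff_def add.commute[of n j] alt_binomial_sum_add_order
  by (simp add: alt_binomial_sum_def atLeast0AtMost)

text \<open>Moves a constant between prefactor and summands; for \<open>k = 3\<close> it cancels the
  2 in the denominator of \<open>stirling_weight_2\<close>.\<close>

lemma eq_series_rescale: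
  assumes "eq_series a (d * c) (\<lambda>n. f n / d)" "d \<noteq> 0"
  shows "eq_series a c f"
proof -
  have "summable (\<lambda>n. f n / d * d)"
    using assms by (intro summable_mult2) (simp add: eq_series_def)
  then have "summable f" using assms(2) by simp
  then show ?thesis
    using assms by (simp add: eq_series_def suminf_divide)
qed

text \<open>The rising factorial vanishes exactly at \<open>s = 1, ..., Suc j\<close>, so off these
  points the continued identity can be divided by it.\<close>

lemma hurwitz_zeta_eq_series:
  assumes v: "Re v > 0" and s: "s \<notin> of_nat ` {1..Suc j}"
  shows "eq_series (hurwitz_zeta s v) (fact (Suc j) / pochhammer (s - of_nat (Suc j)) (Suc j))
     (\<lambda>n. of_real (stirling_weight j n) * hurwitz_diff (n + j) (s - of_nat (Suc j)) v)"
proof -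
  have "s \<noteq> 1" using s by (metis Suc_le_mono atLeastAtMost_iff image_eqI le0 of_nat_1 One_nat_def order.refl)
  then have "pochhammer (s - of_nat (Suc j)) (Suc j) * hurwitz_zeta s v =
           fact (Suc j) * difference_series j (s - of_nat (Suc j)) v"
    by (rule pochhammer_times_hurwitz_zeta[OF v])
  moreover have "pochhammer (s - of_nat (Suc j)) (Suc j) \<noteq> 0"
  proof
    assume "pochhammer (s - of_nat (Suc j)) (Suc j) = 0"
    then obtain i where "i < Suc j" "s - of_nat (Suc j) = - of_nat i"
      unfolding pochhammer_eq_0_iff by blast
    then have "s = of_nat (Suc j - i)" "Suc j - i \<in> {1..Suc j}"
      by (auto simp: of_nat_diff algebra_simps)
    with s show False by blast
  qed
  ultimately show ?thesis
    using difference_series_sums[OF v, of j "s - of_nat (Suc j)"]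
    by (simp add: eq_series_def sums_iff field_simps del: pochhammer_Suc of_nat_Suc fact_Suc)
qed

theorem theorem6:
  fixes v :: complex
  assumes "Re v > 0"
  shows
   "(\<forall>(k::nat) (s::complex). k \<ge> 1 \<longrightarrow> s \<notin> of_nat ` {1..k} \<longrightarrow>
       eq_series (hurwitz_zeta s v) (fact k / pochhammer (s - of_nat k) k)
         (\<lambda>n. of_int \<bar>S1 (n + k) k\<bar> / fact (n + k) *
            (\<Sum>l=0..n + k - 1. (-1) ^ l * of_nat ((n + k - 1) choose l) *
               (of_nat l + v) powr (of_nat k - s))) \<and>
       eq_series (hurwitz_zeta s v) (fact k / pochhammer (s - of_nat k) k)
         (\<lambda>n. of_int \<bar>S1 (n + k) k\<bar> / fact (n + k) *
            (\<Sum>r=0..k - 1. (-1) ^ r * of_nat ((k - 1) choose r) *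
               (\<Sum>l=0..n. (-1) ^ l * of_nat (n choose l) *
                  (of_nat l + of_nat r + v) powr (of_nat k - s))))) \<and>
    (\<forall>s::complex. s \<notin> {1, 2} \<longrightarrow>
       eq_series (hurwitz_zeta s v) (2 / ((s - 1) * (s - 2)))
         (\<lambda>n. harm (n + 1) / of_nat (n + 2) *
            (\<Sum>l=0..n + 1. (-1) ^ l * of_nat ((n + 1) choose l) *
               (of_nat l + v) powr (2 - s))) \<and>
       eq_series (hurwitz_zeta s v) (2 / ((s - 1) * (s - 2)))
         (\<lambda>n. harm (n + 1) / of_nat (n + 2) *
            (\<Sum>l=0..n. (-1) ^ l * of_nat (n choose l) *
               ((of_nat l + v) powr (2 - s) - (of_nat l + v + 1) powr (2 - s))))) \<and>
    (\<forall>s::complex. s \<notin> {1, 2, 3} \<longrightarrow>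
       eq_series (hurwitz_zeta s v) (3 / ((s - 1) * (s - 2) * (s - 3)))
         (\<lambda>n. ((harm (n + 2))\<^sup>2 - harm2 (n + 2)) / of_nat (n + 3) *
            (\<Sum>l=0..n + 2. (-1) ^ l * of_nat ((n + 2) choose l) *
               (of_nat l + v) powr (3 - s))))"
proof (intro conjI allI impI)
  fix k :: nat and s :: complex
  assume "k \<ge> 1" and s: "s \<notin> of_nat ` {1..k}"
  then obtain j where k: "k = Suc j" by (cases k) auto
  have main: "eq_series (hurwitz_zeta s v) (fact k / pochhammer (s - of_nat k) k)
     (\<lambda>n. of_int \<bar>S1 (n + k) k\<bar> / fact (n + k) * hurwitz_diff (n + j) (s - of_nat k) v)"
    using hurwitz_zeta_eq_series[OF assms, of s j] s unfolding k stirling_weight_eq_S1 by blast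
  have k_minus_1: "n + k - 1 = n + j" "k - 1 = j" for n using k by auto
  show "eq_series (hurwitz_zeta s v) (fact k / pochhammer (s - of_nat k) k)
         (\<lambda>n. of_int \<bar>S1 (n + k) k\<bar> / fact (n + k) *
            (\<Sum>l=0..n + k - 1. (-1) ^ l * of_nat ((n + k - 1) choose l) *
               (of_nat l + v) powr (of_nat k - s)))"
    using main unfolding k_minus_1 hurwitz_diff_altdef .
  show "eq_series (hurwitz_zeta s v) (fact k / pochhammer (s - of_nat k) k)
         (\<lambda>n. of_int \<bar>S1 (n + k) k\<bar> / fact (n + k) *
            (\<Sum>r=0..k - 1. (-1) ^ r * of_nat ((k - 1) choose r) *
               (\<Sum>l=0..n. (-1) ^ l * of_nat (n choose l) *
                  (of_nat l + of_nat r + v) powr (of_nat k - s))))"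
    using main unfolding k_minus_1 hurwitz_diff_add_order .
next
  fix s :: complex
  assume s: "s \<notin> {1, 2}"
  have "{1..Suc 1} = {1, 2::nat}" by auto
  then have "s \<notin> of_nat ` {1..Suc 1}" using s by simp
  moreover have "fact (Suc 1) / pochhammer (s - of_nat (Suc 1)) (Suc 1) = 2 / ((s - 1) * (s - 2))"
    by (simp add: pochhammer_Suc mult.commute)
  ultimately have main: "eq_series (hurwitz_zeta s v) (2 / ((s - 1) * (s - 2)))
     (\<lambda>n. harm (n + 1) / of_nat (n + 2) * hurwitz_diff (n + 1) (s - 2) v)"
    using hurwitz_zeta_eq_series[OF assms, of s 1] unfolding stirling_weight_1 by simp
  show "eq_series (hurwitz_zeta s v) (2 / ((s - 1) * (s - 2)))
         (\<lambda>n. harm (n + 1) / of_nat (n + 2) *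
            (\<Sum>l=0..n + 1. (-1) ^ l * of_nat ((n + 1) choose l) *
               (of_nat l + v) powr (2 - s)))"
    using main unfolding hurwitz_diff_altdef .
  \<comment> \<open>A single application of Pascal's rule lowers the order from \<open>n + 1\<close>
    to \<open>n\<close>.\<close>
  have "hurwitz_diff (n + 1) (s - 2) v = (\<Sum>l=0..n. (-1) ^ l * of_nat (n choose l) *
               ((of_nat l + v) powr (2 - s) - (of_nat l + v + 1) powr (2 - s)))" for n
    by (simp add: hurwitz_diff_def alt_binomial_sum_Suc alt_binomial_sum_diff [symmetric] add_ac)
       (simp add: alt_binomial_sum_def atLeast0AtMost)
  with main show "eq_series (hurwitz_zeta s v) (2 / ((s - 1) * (s - 2)))
         (\<lambda>n. harm (n + 1) / of_nat (n + 2) *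
            (\<Sum>l=0..n. (-1) ^ l * of_nat (n choose l) *
               ((of_nat l + v) powr (2 - s) - (of_nat l + v + 1) powr (2 - s))))"
    by simp
next
  fix s :: complex
  assume s: "s \<notin> {1, 2, 3}"
  have "{1..Suc 2} = {1, 2, 3::nat}" by auto
  then have "s \<notin> of_nat ` {1..Suc 2}" using s by simp
  \<comment> \<open>The factorial 6 is written as \<open>2 * 3\<close>, so that the 2 can be moved
    into the summands.\<close>
  moreover have "fact (Suc 2) / pochhammer (s - of_nat (Suc 2)) (Suc 2) =
      2 * (3 / ((s - 1) * (s - 2) * (s - 3)))"
    by (simp add: pochhammer_Suc numeral_2_eq_2 mult_ac)
  ultimately have "eq_series (hurwitz_zeta s v) (2 * (3 / ((s - 1) * (s - 2) * (s - 3))))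
     (\<lambda>n. ((harm (n + 2))\<^sup>2 - harm2 (n + 2)) / of_nat (n + 3) *
        hurwitz_diff (n + 2) (s - 3) v / 2)"
    using hurwitz_zeta_eq_series[OF assms, of s 2] unfolding stirling_weight_2 by (simp add: mult_ac)
  then have "eq_series (hurwitz_zeta s v) (3 / ((s - 1) * (s - 2) * (s - 3)))
     (\<lambda>n. ((harm (n + 2))\<^sup>2 - harm2 (n + 2)) / of_nat (n + 3) *
        hurwitz_diff (n + 2) (s - 3) v)"
    by (rule eq_series_rescale) simp
  then show "eq_series (hurwitz_zeta s v) (3 / ((s - 1) * (s - 2) * (s - 3)))
         (\<lambda>n. ((harm (n + 2))\<^sup>2 - harm2 (n + 2)) / of_nat (n + 3) *
            (\<Sum>l=0..n + 2. (-1) ^ l * of_nat ((n + 2) choose l) *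
               (of_nat l + v) powr (3 - s)))"
    unfolding hurwitz_diff_altdef .
qed

end
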